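(* For each integer $n\ge 0$, let $LG_1(n)$ denote the number of partitions of $n$ in which any two parts differ by at least $2$ and no two consecutive odd numbers (that is, $2s+1$ and $2s-1$ for some integer $s$) both appear as parts. Let $\overline{LG_1}(n)$ denote the number of overpartitions of $n$ in which the non-overlined parts are even and distinct, and the overlined parts are odd and each at most $2r+1$, where $r$ is the number of non-overlined parts. Then $LG_1(n)=\overline{LG_1}(n)$ for every $n\ge 0$.
   Context: A partition of $n$ is a weakly decreasing finite sequence of positive integers (its parts) with sum $n$; parts at different positions count as different parts, so "differ by at least $2$" excludes repeated parts. An overpartition of $n$ is a weakly decreasing finite sequence of positive integers with sum $n$ in which the last occurrence of a part of each given magnitude may or may not be overlined. Thus the overlined parts are automatically distinct from one another. "The non-overlined parts are distinct" means that they are pairwise distinct among themselves. Conditions on parts of a given kind are vacuous if there are no such parts. There is exactly one partition and one overpartition of $0$ (the empty one). *)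

theory Defs
  imports Main
begin

definition is_partition :: "nat \<Rightarrow> nat list \<Rightarrow> bool" where
  "is_partition n xs \<longleftrightarrow>
     sorted_wrt (\<ge>) xs \<and> (\<forall>x\<in>set xs. 0 < x) \<and> sum_list xs = n"

text \<open>
  An entry \<open>(m, b)\<close> of an overpartition is a part of magnitude \<open>m\<close>, overlined iff \<open>b\<close> holds.
  The last clause says that only the last occurrence of each magnitude can be overlined.
\<close>

definition is_overpartition :: "nat \<Rightarrow> (nat \<times> bool) list \<Rightarrow> bool" where
  "is_overpartition n ps \<longleftrightarrow>
     is_partition n (map fst ps) \<and>
     (\<forall>i j. i < j \<and> j < length ps \<and> fst (ps ! i) = fst (ps ! j) \<longrightarrow> \<not> snd (ps ! i))"

definition overlined :: "(nat \<times> bool) list \<Rightarrow> nat list" where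
  "overlined ps = map fst (filter snd ps)"

definition non_overlined :: "(nat \<times> bool) list \<Rightarrow> nat list" where
  "non_overlined ps = map fst (filter (\<lambda>p. \<not> snd p) ps)"

definition LG1_partitions :: "nat \<Rightarrow> nat list set" where
  "LG1_partitions n = {xs. is_partition n xs \<and>
     (\<forall>i<length xs. \<forall>j<length xs. i \<noteq> j \<longrightarrow> 2 \<le> \<bar>int (xs ! i) - int (xs ! j)\<bar>) \<and>
     \<not> (\<exists>s::int. 2 * s + 1 \<in> int ` set xs \<and> 2 * s - 1 \<in> int ` set xs)}"

definition LG1 :: "nat \<Rightarrow> nat" where
  "LG1 n = card (LG1_partitions n)"

definition LG1_overpartitions :: "nat \<Rightarrow> (nat \<times> bool) list set" where
  "LG1_overpartitions n = {ps. is_overpartition n ps \<and>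
     (\<forall>x\<in>set (non_overlined ps). even x) \<and> distinct (non_overlined ps) \<and>
     (\<forall>x\<in>set (overlined ps). odd x \<and> x \<le> 2 * length (non_overlined ps) + 1)}"

definition LG1_over :: "nat \<Rightarrow> nat" where
  "LG1_over n = card (LG1_overpartitions n)"

text \<open>The sets counted above are finite, so \<open>card\<close> is the genuine number of elements.\<close>

lemma length_le_sum_list: "\<forall>x\<in>set xs. 0 < x \<Longrightarrow> length xs \<le> sum_list (xs :: nat list)"
  by (induction xs) auto

lemma finite_overpartitions: "finite {ps. is_overpartition n ps}"
proof (rule finite_subset)
  show "{ps. is_overpartition n ps} \<subseteq> {ps. set ps \<subseteq> {..n} \<times> UNIV \<and> length ps \<le> n}"
  proof clarify
    fix ps :: "(nat \<times> bool) list"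
    assume "is_overpartition n ps"
    then have "is_partition n (map fst ps)"
      by (simp add: is_overpartition_def)
    then have p: "\<forall>x\<in>set (map fst ps). 0 < x" and s: "sum_list (map fst ps) = n"
      unfolding is_partition_def by blast+
    have "length ps \<le> n"
      using length_le_sum_list[OF p] s by simp
    moreover have "fst q \<le> n" if "q \<in> set ps" for q
      using that s member_le_sum_list[of "fst q" "map fst ps"] by force
    ultimately show "set ps \<subseteq> {..n} \<times> UNIV \<and> length ps \<le> n"
      by auto
  qed
  show "finite {ps :: (nat \<times> bool) list. set ps \<subseteq> {..n} \<times> UNIV \<and> length ps \<le> n}"
    by (rule finite_lists_length_le) simp
qed

lemma finite_partitions: "finite {xs. is_partition n xs}"
proof (rule finite_subset)
  have "map fst (map (\<lambda>x. (x, False)) xs) = xs" for xs :: "nat list"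
    by (simp add: comp_def)
  moreover have "is_overpartition n (map (\<lambda>x. (x, False)) xs)" if "is_partition n xs" for xs
    using that by (simp add: is_overpartition_def comp_def)
  ultimately show "{xs. is_partition n xs} \<subseteq> map fst ` {ps. is_overpartition n ps}"
    by (metis (no_types, lifting) image_eqI mem_Collect_eq subsetI)
qed (simp add: finite_overpartitions)

lemma finite_LG1_partitions: "finite (LG1_partitions n)"
  by (rule finite_subset[OF _ finite_partitions]) (auto simp: LG1_partitions_def)

lemma finite_LG1_overpartitions: "finite (LG1_overpartitions n)"
  by (rule finite_subset[OF _ finite_overpartitions]) (auto simp: LG1_overpartitions_def)

end

theory Submission
  imports Defs
begin

text \<open>
  An overpartition of the kind counted here never repeats a magnitude, and parity tells which parts
  are overlined, so it is a finite set of positive integers: even elements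
  \<open>e\<^sub>1 > \<dots> > e\<^sub>r\<close> and odd elements of the form \<open>2 * j - 1\<close> with \<open>1 \<le> j \<le> r + 1\<close>.
  Read the odd element \<open>2 * j - 1\<close> as a mark on \<open>e\<^sub>j\<close>, where \<open>e\<close> is first extended by
  \<open>e\<^sub>r\<^sub>+\<^sub>1 = 0\<close> in case \<open>2 * r + 1\<close> is present. Now distribute every marked odd element over the
  even ones: \<open>2 * j - 1\<close> adds \<open>2\<close> to each of the \<open>j - 1\<close> numbers before \<open>e\<^sub>j\<close> and \<open>1\<close> to
  \<open>e\<^sub>j\<close> itself. The total is unchanged, and the result is
  \<open>x\<^sub>i = e\<^sub>i + [i marked] + 2 * (number of marks after i)\<close>.

  The marks are exactly the positions of the odd \<open>x\<^sub>i\<close>, so they can be recovered and the process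
  reversed. Moreover
  \<open>x\<^sub>i - x\<^sub>i\<^sub>+\<^sub>1 = (e\<^sub>i - e\<^sub>i\<^sub>+\<^sub>1) + [i marked] + [i + 1 marked]\<close>. Hence the condition that the even
  numbers \<open>e\<^sub>i\<close> are strictly decreasing (gaps at least \<open>2\<close>) says that the \<open>x\<^sub>i\<close> have gaps at
  least \<open>2\<close>, and at least \<open>4\<close> between neighbouring odd ones (if just one of \<open>x\<^sub>i\<close>,
  \<open>x\<^sub>i\<^sub>+\<^sub>1\<close> is odd, the gap is odd and \<open>2\<close> already forces \<open>3\<close>). This is the condition on the
  partition side, where two odd parts may not differ by exactly \<open>2\<close>. The number \<open>0\<close> may
  only occur as a marked last entry, and corresponds to a smallest part equal to \<open>1\<close>.

  The proof composes three bijections: \<open>bij_betw_distribute\<close> from marked lists to partitions,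
  \<open>bij_betw_mark_set\<close> from marked lists to sets, and \<open>bij_betw_magnitudes\<close> from overpartitions
  to sets.
\<close>

section \<open>Marked lists of even numbers and gap partitions\<close>

definition gap_list :: "nat list \<Rightarrow> bool" where
  "gap_list xs \<longleftrightarrow> (\<forall>x\<in>set xs. 0 < x) \<and>
     sorted_wrt (\<lambda>x y. y + 2 \<le> x \<and> (odd x \<and> odd y \<longrightarrow> y + 4 \<le> x)) xs"

text \<open>
  The distance of two odd parts is even, so excluding the distance \<open>2\<close> (consecutive odd numbers)
  raises the required gap from \<open>2\<close> to \<open>4\<close>.
\<close>

lemma LG1_partitions_eq: "LG1_partitions n = {xs. gap_list xs \<and> sum_list xs = n}"
proof (intro set_eqI iffI)
  fix xs assume "xs \<in> LG1_partitions n"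
  then have part: "is_partition n xs"
    and diff: "\<And>i j. i < length xs \<Longrightarrow> j < length xs \<Longrightarrow> i \<noteq> j \<Longrightarrow> 2 \<le> \<bar>int (xs ! i) - int (xs ! j)\<bar>"
    and odds: "\<And>s::int. \<not> (2 * s + 1 \<in> int ` set xs \<and> 2 * s - 1 \<in> int ` set xs)"
    unfolding LG1_partitions_def by blast+
  have "xs ! j + 2 \<le> xs ! i \<and> (odd (xs ! i) \<and> odd (xs ! j) \<longrightarrow> xs ! j + 4 \<le> xs ! i)"
    if ij: "i < j" "j < length xs" for i j
  proof -
    have "xs ! j \<le> xs ! i"
      using part ij by (auto simp: is_partition_def sorted_wrt_iff_nth_less)
    then have gap: "xs ! j + 2 \<le> xs ! i"
      using diff[of i j] ij by auto
    moreover have "xs ! j + 4 \<le> xs ! i" if odd: "odd (xs ! i)" "odd (xs ! j)"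
    proof (rule ccontr)
      assume "\<not> xs ! j + 4 \<le> xs ! i"
      then have eq: "xs ! i = xs ! j + 2"
        using gap odd by presburger
      obtain k where k: "xs ! j = 2 * k + 1"
        using odd(2) by (elim oddE)
      have "int (xs ! i) \<in> int ` set xs" "int (xs ! j) \<in> int ` set xs"
        using ij by auto
      then show False
        using odds[of "int k + 1"] eq k by (simp add: algebra_simps)
    qed
    ultimately show ?thesis by blast
  qed
  then show "xs \<in> {xs. gap_list xs \<and> sum_list xs = n}"
    using part by (auto simp: gap_list_def is_partition_def sorted_wrt_iff_nth_less)
next
  fix xs assume "xs \<in> {xs. gap_list xs \<and> sum_list xs = n}"
  then have gap: "gap_list xs" and sum: "sum_list xs = n"
    by auto
  have nth: "xs ! j + 2 \<le> xs ! i \<and> (odd (xs ! i) \<and> odd (xs ! j) \<longrightarrow> xs ! j + 4 \<le> xs ! i)"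
    if "i < j" "j < length xs" for i j
    using gap that by (auto simp: gap_list_def sorted_wrt_iff_nth_less)
  have "sorted_wrt (\<ge>) xs"
    unfolding sorted_wrt_iff_nth_less using nth by (meson add_leD1)
  then have "is_partition n xs"
    using gap sum by (simp add: gap_list_def is_partition_def)
  moreover have "2 \<le> \<bar>int (xs ! i) - int (xs ! j)\<bar>"
    if "i < length xs" "j < length xs" "i \<noteq> j" for i j
    using nth[of i j] nth[of j i] that by (cases i j rule: linorder_cases) auto
  moreover have "\<not> (2 * s + 1 \<in> int ` set xs \<and> 2 * s - 1 \<in> int ` set xs)" for s :: int
  proof
    assume "2 * s + 1 \<in> int ` set xs \<and> 2 * s - 1 \<in> int ` set xs"
    then obtain i j where ij: "i < length xs" "j < length xs"
      "int (xs ! i) = 2 * s + 1" "int (xs ! j) = 2 * s - 1"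
      by (auto simp: in_set_conv_nth)
    then have "odd (xs ! i)" "odd (xs ! j)" "xs ! i = xs ! j + 2"
      by presburger+
    moreover have "i < j \<or> j < i"
      using ij(3,4) by (cases i j rule: linorder_cases) auto
    ultimately show False
      using nth[of i j] nth[of j i] ij(1,2) by linarith
  qed
  ultimately show "xs \<in> LG1_partitions n"
    by (simp add: LG1_partitions_def)
qed

text \<open>
  The flag of an entry is its mark. An entry \<open>0\<close> stands for no even part at all; it is there only
  to carry the mark that corresponds to the largest admissible odd part.
\<close>

definition marked_list :: "(nat \<times> bool) list \<Rightarrow> bool" where
  "marked_list ps \<longleftrightarrow> (\<forall>(e, b)\<in>set ps. even e \<and> (e = 0 \<longrightarrow> b)) \<and>
     sorted_wrt (>) (map fst ps)"

abbreviation marks :: "(nat \<times> bool) list \<Rightarrow> nat" where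
  "marks ps \<equiv> length (filter snd ps)"

abbreviation odd_parts :: "nat list \<Rightarrow> nat" where
  "odd_parts xs \<equiv> length (filter odd xs)"

fun distribute :: "(nat \<times> bool) list \<Rightarrow> nat list" where
  "distribute [] = []"
| "distribute ((e, b) # ps) = (e + of_bool b + 2 * marks ps) # distribute ps"

fun collect :: "nat list \<Rightarrow> (nat \<times> bool) list" where
  "collect [] = []"
| "collect (x # xs) = (2 * (x div 2) - 2 * odd_parts xs, odd x) # collect xs"

lemma odd_parts_distribute: "marked_list ps \<Longrightarrow> odd_parts (distribute ps) = marks ps"
  by (induction ps rule: distribute.induct) (auto simp: marked_list_def)

lemma collect_distribute: "marked_list ps \<Longrightarrow> collect (distribute ps) = ps"
proof (induction ps rule: distribute.induct)
  case (2 e b ps)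
  then have "marked_list ps" "even e"
    by (auto simp: marked_list_def)
  with 2 show ?case
    by (auto simp: odd_parts_distribute)
qed simp

text \<open>
  For comparing a new head with all later entries at once: \<open>c\<close> is the number of marks strictly
  after the entry \<open>(e, b)\<close>, so that \<open>c\<close> and the entry's own mark together are covered by
  \<open>marks ps\<close>, which is what the head receives (twice).
\<close>

lemma in_set_distribute:
  assumes "y \<in> set (distribute ps)"
  shows "\<exists>(e, b)\<in>set ps. \<exists>c. y = e + of_bool b + 2 * c \<and> c + of_bool b \<le> marks ps"
  using assms
proof (induction ps rule: distribute.induct)
  case (2 e b ps)
  show ?case
  proof (cases "y \<in> set (distribute ps)")
    case True
    with 2 obtain e' b' c where "(e', b') \<in> set ps" "y = e' + of_bool b' + 2 * c"
      "c + of_bool b' \<le> marks ps"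
      by auto
    then show ?thesis
      by (intro bexI[of _ "(e', b')"]) auto
  next
    case False
    with 2 show ?thesis by auto
  qed
qed simp

lemma gap_list_distribute: "marked_list ps \<Longrightarrow> gap_list (distribute ps)"
proof (induction ps rule: distribute.induct)
  case (2 e b ps)
  then have ps: "marked_list ps" and e: "even e" "e = 0 \<longrightarrow> b"
    and less: "\<And>e' b'. (e', b') \<in> set ps \<Longrightarrow> e' < e \<and> even e'"
    by (auto simp: marked_list_def)
  define x where "x = e + of_bool b + 2 * marks ps"
  have "y + 2 \<le> x \<and> (odd x \<and> odd y \<longrightarrow> y + 4 \<le> x)" if y: "y \<in> set (distribute ps)" for y
  proof -
    obtain e' b' c where eb: "(e', b') \<in> set ps" "y = e' + of_bool b' + 2 * c"
      "c + of_bool b' \<le> marks ps"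
      using in_set_distribute[OF y] by auto
    have "e' + 2 \<le> e" "even e'"
      using less[OF eb(1)] e(1) by presburger+
    then show ?thesis
      using eb(2,3) e(1) by (cases b; cases b') (auto simp: x_def)
  qed
  moreover have "0 < x"
    using e by (auto simp: x_def)
  ultimately show ?case
    using "2.IH"[OF ps] by (simp add: gap_list_def x_def)
qed (simp add: gap_list_def)

text \<open>
  After rounding down to even numbers, an odd \<open>y\<close> still leaves an extra gap of \<open>2\<close>. This is
  exactly what \<open>x\<close> loses on account of \<open>y\<close> in \<open>collect\<close>, so the even numbers obtained there
  remain strictly decreasing.
\<close>

lemma gap_list_step:
  assumes "gap_list (x # y # xs)"
  shows "2 * (y div 2) + 2 * of_bool (odd y) + 2 \<le> 2 * (x div 2)"
proof -
  have "y + 2 \<le> x" "odd x \<and> odd y \<longrightarrow> y + 4 \<le> x"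
    using assms by (auto simp: gap_list_def)
  then show ?thesis
    by (cases "odd y") (simp; presburger)+
qed

text \<open>
  Summing the extra gaps shows that the truncated subtraction in \<open>collect\<close> is a true one.
\<close>

lemma odd_parts_le:
  assumes "gap_list (x # xs)"
  shows "2 * odd_parts xs \<le> 2 * (x div 2)"
  using assms
proof (induction xs arbitrary: x)
  case (Cons y xs)
  then have "gap_list (y # xs)"
    by (simp add: gap_list_def)
  with Cons.IH[of y] gap_list_step[OF Cons.prems] show ?case
    by auto
qed simp

lemma distribute_collect: "gap_list xs \<Longrightarrow> distribute (collect xs) = xs"
proof (induction xs)
  case (Cons x xs)
  then have xs: "gap_list xs"
    by (simp add: gap_list_def)
  have "marks (collect ys) = odd_parts ys" for ys
    by (induction ys) auto
  moreover have "2 * (x div 2) + of_bool (odd x) = x"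
    by (cases "odd x") auto
  ultimately show ?case
    using Cons.IH[OF xs] odd_parts_le[OF Cons.prems] by auto
qed simp

lemma marked_list_collect: "gap_list xs \<Longrightarrow> marked_list (collect xs)"
proof (induction xs rule: induct_list012)
  case 1
  then show ?case by (simp add: marked_list_def)
next
  case (2 x)
  then show ?case by (auto simp: marked_list_def gap_list_def elim: oddE)
next
  case (3 x y zs)
  then have y: "gap_list (y # zs)"
    by (simp add: gap_list_def)
  then have ml: "marked_list (collect (y # zs))"
    using 3 by blast
  define e where "e = 2 * (x div 2) - 2 * odd_parts (y # zs)"
  have less: "2 * (y div 2) - 2 * odd_parts zs < e"
    using gap_list_step[OF "3.prems"] odd_parts_le[OF y] by (auto simp: e_def)
  have "even e"
    by (simp add: e_def)
  moreover have "fst p < e" if "p \<in> set (collect (y # zs))" for p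
    using that ml less by (auto simp: marked_list_def)
  ultimately have "marked_list ((e, odd x) # collect (y # zs))"
    using ml less by (auto simp: marked_list_def simp del: collect.simps)
  then show ?case
    by (simp add: e_def)
qed

lemma bij_betw_distribute:
  "bij_betw distribute {ps. marked_list ps \<and> sum_list (distribute ps) = n} (LG1_partitions n)"
  unfolding LG1_partitions_eq
  by (rule bij_betw_byWitness[where f' = collect])
    (auto simp: collect_distribute distribute_collect gap_list_distribute marked_list_collect)

section \<open>Marked lists and sets of positive integers\<close>

definition mark_positions :: "(nat \<times> bool) list \<Rightarrow> nat set" where
  "mark_positions ps = {2 * i + 1 | i. i < length ps \<and> snd (ps ! i)}"

definition mark_set :: "(nat \<times> bool) list \<Rightarrow> nat set" where
  "mark_set ps = (fst ` set ps - {0}) \<union> mark_positions ps"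

lemma mark_positions_Cons:
  "mark_positions ((e, b) # ps) = (if b then {1} else {}) \<union> (\<lambda>m. m + 2) ` mark_positions ps"
  (is "?L = ?R")
proof (rule set_eqI)
  fix m
  show "m \<in> ?L \<longleftrightarrow> m \<in> ?R"
  proof
    assume "m \<in> ?L"
    then obtain i where "m = 2 * i + 1" "i < Suc (length ps)" "snd (((e, b) # ps) ! i)"
      by (auto simp: mark_positions_def)
    then show "m \<in> ?R"
      by (cases i) (auto simp: mark_positions_def image_iff)
  next
    assume "m \<in> ?R"
    then consider "b" "m = 1" | i where "i < length ps" "snd (ps ! i)" "m = 2 * Suc i + 1"
      by (auto simp: mark_positions_def split: if_splits)
    then show "m \<in> ?L"
    proof cases
      case 1
      then show ?thesis by (force simp: mark_positions_def)
    next
      case 2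
      then show ?thesis
        unfolding mark_positions_def by (intro CollectI exI[of _ "Suc i"]) simp
    qed
  qed
qed

lemma finite_mark_positions [simp]: "finite (mark_positions ps)"
  by (simp add: mark_positions_def)

lemma card_mark_positions: "card (mark_positions ps) = marks ps"
proof (induction ps)
  case (Cons p ps)
  have "1 \<notin> (\<lambda>m. m + 2) ` mark_positions ps"
    by auto
  moreover have "card ((\<lambda>m. m + 2) ` mark_positions ps) = marks ps"
    using Cons by (subst card_image) (auto intro: inj_onI)
  ultimately show ?case
    by (cases p) (simp add: mark_positions_Cons)
qed (simp add: mark_positions_def)

lemma odd_mark_positions: "m \<in> mark_positions ps \<Longrightarrow> odd m"
  by (auto simp: mark_positions_def)

text \<open>
  Conservation of the total: a mark at position \<open>i\<close> (counted from \<open>0\<close>) contributes \<open>2\<close> to each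
  of the \<open>i\<close> earlier entries and \<open>1\<close> to its own, hence \<open>2 * i + 1\<close> overall.
\<close>

lemma sum_list_distribute:
  "sum_list (distribute ps) = sum_list (map fst ps) + \<Sum>(mark_positions ps)"
proof (induction ps rule: distribute.induct)
  case 1
  then show ?case by (simp add: mark_positions_def)
next
  case (2 e b ps)
  have "1 \<notin> (\<lambda>m. m + 2) ` mark_positions ps"
    by auto
  moreover have "\<Sum>((\<lambda>m. m + 2) ` mark_positions ps) = \<Sum>(mark_positions ps) + 2 * marks ps"
    by (subst sum.reindex)
      (auto intro: inj_onI simp: sum.distrib card_mark_positions simp flip: add_2_eq_Suc')
  ultimately have "\<Sum>(mark_positions ((e, b) # ps)) =
      of_bool b + \<Sum>(mark_positions ps) + 2 * marks ps"
    by (simp add: mark_positions_Cons)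
  with 2 show ?case by simp
qed

lemma sorted_wrt_gt_distinct: "sorted_wrt (>) xs \<Longrightarrow> distinct (xs :: nat list)"
  by (induction xs) auto

lemma sorted_wrt_gt_unique:
  fixes xs ys :: "nat list"
  assumes "sorted_wrt (>) xs" "sorted_wrt (>) ys" "set xs = set ys"
  shows "xs = ys"
proof -
  have "sorted_wrt (<) (rev xs)" "sorted_wrt (<) (rev ys)"
    using assms by (simp_all add: sorted_wrt_rev)
  then have "rev xs = rev ys"
    using assms(3) by (intro strict_sorted_equal) auto
  then show ?thesis by simp
qed

lemma even_entry: "marked_list ps \<Longrightarrow> (e, b) \<in> set ps \<Longrightarrow> even e"
  by (auto simp: marked_list_def)

lemma sum_mark_set:
  assumes "marked_list ps"
  shows "\<Sum>(mark_set ps) = sum_list (distribute ps)"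
proof -
  have "(fst ` set ps - {0}) \<inter> mark_positions ps = {}"
    using even_entry[OF assms] odd_mark_positions by fastforce
  then have "\<Sum>(mark_set ps) = \<Sum>(fst ` set ps - {0}) + \<Sum>(mark_positions ps)"
    unfolding mark_set_def by (intro sum.union_disjoint) auto
  also have "\<Sum>(fst ` set ps - {0}) = \<Sum>(set (map fst ps))"
    by (intro sum.mono_neutral_left) auto
  also have "\<dots> = sum_list (map fst ps)"
    using assms sorted_wrt_gt_distinct
    by (subst sum_list_distinct_conv_sum_set[where f = "\<lambda>x. x", simplified])
      (auto simp: marked_list_def simp del: set_map)
  finally show ?thesis
    by (simp add: sum_list_distribute)
qed

definition odd_bounded_set :: "nat set \<Rightarrow> bool" where
  "odd_bounded_set S \<longleftrightarrow> finite S \<and> 0 \<notin> S \<and>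
     (\<forall>x\<in>S. odd x \<longrightarrow> x \<le> 2 * card {y\<in>S. even y} + 1)"

lemma even_mark_set: "marked_list ps \<Longrightarrow> {y\<in>mark_set ps. even y} = fst ` set ps - {0}"
  by (auto simp: mark_set_def dest: odd_mark_positions even_entry)

lemma odd_mark_set: "marked_list ps \<Longrightarrow> {y\<in>mark_set ps. odd y} = mark_positions ps"
  by (auto simp: mark_set_def dest: odd_mark_positions even_entry)

lemma length_marked_list:
  assumes "marked_list ps"
  shows "length ps = card {y\<in>mark_set ps. even y} + of_bool (0 \<in> fst ` set ps)"
proof -
  have "distinct (map fst ps)"
    using assms by (auto simp: marked_list_def intro: sorted_wrt_gt_distinct)
  then have "length ps = card (fst ` set ps)"
    using distinct_card[of "map fst ps"] by simp
  also have "\<dots> = card (fst ` set ps - {0}) + of_bool (0 \<in> fst ` set ps)"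
    using card.remove[of "fst ` set ps" 0] by (cases "0 \<in> fst ` set ps") simp_all
  finally show ?thesis
    by (simp add: even_mark_set[OF assms])
qed

lemma odd_bounded_mark_set:
  assumes "marked_list ps"
  shows "odd_bounded_set (mark_set ps)"
proof -
  have "x \<le> 2 * card {y\<in>mark_set ps. even y} + 1" if "x \<in> mark_set ps" "odd x" for x
  proof -
    have "x \<in> mark_positions ps"
      using odd_mark_set[OF assms] that by auto
    then have "x + 1 \<le> 2 * length ps"
      by (auto simp: mark_positions_def)
    then show ?thesis
      using length_marked_list[OF assms] by (cases "0 \<in> fst ` set ps") auto
  qed
  then show ?thesis
    by (auto simp: odd_bounded_set_def mark_set_def mark_positions_def)
qed

text \<open>
  The entry \<open>0\<close> leaves no trace among the even elements, but it is recoverable: being smallest it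
  stands last, at position \<open>r\<close> if there are \<open>r\<close> even elements, and its compulsory mark is the element \<open>2 * r + 1\<close>, which no
  shorter list can produce.
\<close>

lemma zero_entry_iff:
  assumes "marked_list ps"
  shows "0 \<in> fst ` set ps \<longleftrightarrow> 2 * card {y\<in>mark_set ps. even y} + 1 \<in> mark_set ps"
    (is "_ \<longleftrightarrow> 2 * ?r + 1 \<in> _")
proof
  assume zero: "0 \<in> fst ` set ps"
  then obtain i where i: "i < length ps" "fst (ps ! i) = 0"
    by (auto simp: in_set_conv_nth)
  have len: "length ps = ?r + 1"
    using length_marked_list[OF assms] zero by simp
  have "\<not> i < ?r"
  proof
    assume "i < ?r"
    then have "map fst ps ! ?r < map fst ps ! i"
      using assms len by (auto simp: marked_list_def sorted_wrt_iff_nth_less)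
    with i show False by simp
  qed
  with i len have "i = ?r"
    by simp
  moreover have "snd (ps ! i)"
    using assms nth_mem[OF i(1)] i(2) by (cases "ps ! i") (auto simp: marked_list_def)
  ultimately have "2 * ?r + 1 \<in> mark_positions ps"
    using i(1) by (auto simp: mark_positions_def)
  then show "2 * ?r + 1 \<in> mark_set ps"
    by (simp add: mark_set_def)
next
  assume "2 * ?r + 1 \<in> mark_set ps"
  then have "2 * ?r + 1 \<in> {y\<in>mark_set ps. odd y}"
    by simp
  then have "2 * ?r + 1 \<in> mark_positions ps"
    by (simp only: odd_mark_set[OF assms])
  then have "?r < length ps"
    by (auto simp: mark_positions_def)
  then show "0 \<in> fst ` set ps"
    using length_marked_list[OF assms] by (cases "0 \<in> fst ` set ps") auto
qed

lemma inj_on_mark_set: "inj_on mark_set {ps. marked_list ps}"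
proof (rule inj_onI, unfold mem_Collect_eq)
  fix ps qs
  assume ps: "marked_list ps" and qs: "marked_list qs" and eq: "mark_set ps = mark_set qs"
  have nonzero: "fst ` set ps - {0} = fst ` set qs - {0}"
    using even_mark_set[OF ps] even_mark_set[OF qs] eq by simp
  have zero: "0 \<in> fst ` set ps \<longleftrightarrow> 0 \<in> fst ` set qs"
    using zero_entry_iff[OF ps] zero_entry_iff[OF qs] eq by simp
  have "A = B" if "A - {0} = B - {0}" "0 \<in> A \<longleftrightarrow> 0 \<in> B" for A B :: "nat set"
    using that by blast
  from this[OF nonzero zero] have "fst ` set ps = fst ` set qs" .
  then have "set (map fst ps) = set (map fst qs)"
    by simp
  then have fsts: "map fst ps = map fst qs"
    using ps qs by (intro sorted_wrt_gt_unique) (auto simp: marked_list_def)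
  then have len: "length ps = length qs"
    by (metis length_map)
  have pos: "mark_positions ps = mark_positions qs"
    using odd_mark_set[OF ps] odd_mark_set[OF qs] eq by simp
  have mark_iff: "2 * i + 1 \<in> mark_positions rs \<longleftrightarrow> snd (rs ! i)" if "i < length rs" for i rs
    using that by (auto simp: mark_positions_def)
  show "ps = qs"
  proof (rule nth_equalityI[OF len])
    fix i assume i: "i < length ps"
    have "fst (ps ! i) = fst (qs ! i)"
      using fsts i len by (metis nth_map)
    moreover have "snd (ps ! i) = snd (qs ! i)"
      using mark_iff[of i ps] mark_iff[of i qs] pos i len by simp
    ultimately show "ps ! i = qs ! i"
      by (rule prod_eqI)
  qed
qed

text \<open>
  The bound on the odd elements is what lets them all become marks: an odd element \<open>2 * i + 1\<close>
  with \<open>i < r\<close> meets an even element at position \<open>i\<close>, and \<open>2 * r + 1\<close>, if present, brings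
  its own entry \<open>0\<close>.
\<close>

lemma mark_set_surj:
  assumes "odd_bounded_set S"
  shows "\<exists>ps. marked_list ps \<and> mark_set ps = S"
proof -
  define E where "E = {y\<in>S. even y}"
  define r where "r = card E"
  have fin: "finite E" and bound: "\<And>x. x \<in> S \<Longrightarrow> odd x \<Longrightarrow> x \<le> 2 * r + 1" and "0 \<notin> S"
    using assms by (auto simp: odd_bounded_set_def E_def r_def)
  define es where "es = rev (sorted_list_of_set E) @ (if 2 * r + 1 \<in> S then [0] else [])"
  define ps where "ps = map (\<lambda>i. (es ! i, 2 * i + 1 \<in> S)) [0..<length es]"
  have es: "map fst ps = es"
    by (simp add: ps_def comp_def map_nth)
  have pos: "\<And>y. y \<in> E \<Longrightarrow> 0 < y"
    using \<open>0 \<notin> S\<close> by (auto simp: E_def intro: gr0I)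
  have len: "length es = r + of_bool (2 * r + 1 \<in> S)"
    using fin by (simp add: es_def r_def)
  have set_es: "set es = E \<union> (if 2 * r + 1 \<in> S then {0} else {})"
    using fin by (simp add: es_def)
  have sorted: "sorted_wrt (>) es"
    using fin pos by (auto simp: es_def sorted_wrt_append sorted_wrt_rev)
  have "even e \<and> (e = 0 \<longrightarrow> b)" if "(e, b) \<in> set ps" for e b
  proof -
    obtain i where i: "i < length es" "e = es ! i" "b \<longleftrightarrow> 2 * i + 1 \<in> S"
      using \<open>(e, b) \<in> set ps\<close> by (auto simp: ps_def)
    have "even e"
      using nth_mem[OF i(1)] i(2) set_es by (auto simp: E_def split: if_splits)
    moreover have b if "e = 0"
    proof -
      have "\<not> i < r"
      proof
        assume "i < r"
        then have "i < length (rev (sorted_list_of_set E))"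
          by (simp add: r_def)
        then have "es ! i \<in> set (rev (sorted_list_of_set E))"
          unfolding es_def nth_append by (simp only: if_True nth_mem)
        then have "es ! i \<in> E"
          using fin by simp
        then show False
          using pos[of "es ! i"] i(2) that by simp
      qed
      then show b
        using i len by (cases "2 * r + 1 \<in> S") (auto simp: less_Suc_eq)
    qed
    ultimately show ?thesis by blast
  qed
  then have ml: "marked_list ps"
    using sorted es by (auto simp: marked_list_def)
  have "mark_positions ps = {x\<in>S. odd x}"
  proof (rule set_eqI)
    fix x
    show "x \<in> mark_positions ps \<longleftrightarrow> x \<in> {x\<in>S. odd x}"
    proof
      assume "x \<in> {x\<in>S. odd x}"
      then obtain i where i: "x = 2 * i + 1" "x \<in> S"
        by (auto elim: oddE)
      then have "i \<le> r"
        using bound[of x] by auto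
      then have "i < length es"
        using i len by (cases "i = r") auto
      then show "x \<in> mark_positions ps"
        using i by (auto simp: mark_positions_def ps_def)
    qed (auto simp: mark_positions_def ps_def)
  qed
  moreover have "fst ` set ps - {0} = E"
  proof -
    have "fst ` set ps = set es"
      by (metis es list.set_map)
    moreover have "0 \<notin> E"
      using pos by blast
    ultimately show ?thesis
      by (auto simp: set_es)
  qed
  ultimately have "mark_set ps = S"
    by (auto simp: mark_set_def E_def)
  with ml show ?thesis by blast
qed

lemma bij_betw_mark_set:
  "bij_betw mark_set {ps. marked_list ps \<and> sum_list (distribute ps) = n}
     {S. odd_bounded_set S \<and> \<Sum>S = n}"
proof (rule bij_betw_imageI)
  show "inj_on mark_set {ps. marked_list ps \<and> sum_list (distribute ps) = n}"
    by (rule inj_on_subset[OF inj_on_mark_set]) auto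
  show "mark_set ` {ps. marked_list ps \<and> sum_list (distribute ps) = n} =
      {S. odd_bounded_set S \<and> \<Sum>S = n}" (is "?L = ?R")
  proof
    show "?L \<subseteq> ?R"
      by (auto simp: odd_bounded_mark_set sum_mark_set)
    show "?R \<subseteq> ?L"
    proof
      fix S assume S: "S \<in> ?R"
      then obtain ps where "marked_list ps" "mark_set ps = S"
        using mark_set_surj by blast
      then show "S \<in> ?L"
        using S sum_mark_set by force
    qed
  qed
qed

section \<open>Overpartitions as sets\<close>

lemma distinct_map_filter_nth:
  assumes "distinct (map f (filter P xs))" "i < j" "j < length xs" "P (xs ! i)" "P (xs ! j)"
  shows "f (xs ! i) \<noteq> f (xs ! j)"
  using assms
proof (induction xs arbitrary: i j)
  case (Cons x xs)
  obtain j' where j': "j = Suc j'"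
    using Cons.prems(2) by (cases j) auto
  show ?case
  proof (cases i)
    case 0
    then show ?thesis
      using Cons.prems j' by auto
  next
    case (Suc i')
    then show ?thesis
      using Cons.prems j' Cons.IH[of i' j'] by (auto split: if_splits)
  qed
qed simp

lemma LG1_overpartition_props:
  assumes "ps \<in> LG1_overpartitions n"
  shows "\<And>p. p \<in> set ps \<Longrightarrow> snd p = odd (fst p)" and "sorted_wrt (>) (map fst ps)"
proof -
  show parity: "snd p = odd (fst p)" if "p \<in> set ps" for p
  proof (cases "snd p")
    case True
    then have "fst p \<in> set (overlined ps)"
      using that by (simp add: overlined_def)
    then show ?thesis
      using assms True by (simp add: LG1_overpartitions_def)
  next
    case False
    then have "fst p \<in> set (non_overlined ps)"
      using that by (simp add: non_overlined_def)
    then show ?thesis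
      using assms False by (simp add: LG1_overpartitions_def)
  qed
  have "fst (ps ! j) < fst (ps ! i)" if ij: "i < j" "j < length ps" for i j
  proof -
    have "fst (ps ! j) \<le> fst (ps ! i)"
      using assms ij
      by (auto simp: LG1_overpartitions_def is_overpartition_def is_partition_def
          sorted_wrt_iff_nth_less)
    moreover have "fst (ps ! j) \<noteq> fst (ps ! i)"
    proof
      \<comment> \<open>Of two equal magnitudes only the last may be overlined, and overlining depends on the
        magnitude alone, so neither is; but the non-overlined parts are distinct.\<close>
      assume eq: "fst (ps ! j) = fst (ps ! i)"
      have "is_overpartition n ps"
        using assms by (simp add: LG1_overpartitions_def)
      then have "\<not> snd (ps ! i)"
        using ij eq[symmetric] unfolding is_overpartition_def by blast
      moreover from this have "\<not> snd (ps ! j)"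
        using eq parity[of "ps ! i"] parity[of "ps ! j"] ij by simp
      ultimately show False
        using eq distinct_map_filter_nth[of fst "\<lambda>p. \<not> snd p" ps i j] assms ij
        by (auto simp: LG1_overpartitions_def non_overlined_def)
    qed
    ultimately show ?thesis by simp
  qed
  then show "sorted_wrt (>) (map fst ps)"
    by (auto simp: sorted_wrt_iff_nth_less)
qed

lemma LG1_overpartitions_eq:
  "LG1_overpartitions n =
     map (\<lambda>x. (x, odd x)) ` {xs. sorted_wrt (>) xs \<and> odd_bounded_set (set xs) \<and> sum_list xs = n}"
  (is "_ = ?m ` ?X")
proof -
  have over: "overlined (?m xs) = filter odd xs"
    and non_over: "non_overlined (?m xs) = filter even xs" for xs
    by (simp_all add: overlined_def non_overlined_def filter_map comp_def)
  have fst_m: "map fst (?m xs) = xs" for xs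
    by (simp add: comp_def)
  have len: "length (filter even xs) = card {y\<in>set xs. even y}" if "sorted_wrt (>) xs" for xs :: "nat list"
    using distinct_card[of "filter even xs"] sorted_wrt_gt_distinct[OF that] by simp
  show ?thesis
  proof
    show "LG1_overpartitions n \<subseteq> ?m ` ?X"
    proof
      fix ps assume ps: "ps \<in> LG1_overpartitions n"
      define xs where "xs = map fst ps"
      have sorted: "sorted_wrt (>) xs"
        using LG1_overpartition_props(2)[OF ps] by (simp add: xs_def)
      have ps_eq: "ps = ?m xs"
        unfolding xs_def map_map
        by (rule map_idI[symmetric]) (simp add: prod_eq_iff LG1_overpartition_props(1)[OF ps])
      have "is_partition n xs" "\<forall>x\<in>set (filter odd xs). x \<le> 2 * length (filter even xs) + 1"
      proof -
        have "?m xs \<in> LG1_overpartitions n"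
          by (simp only: ps_eq[symmetric] ps)
        then show "is_partition n xs" "\<forall>x\<in>set (filter odd xs). x \<le> 2 * length (filter even xs) + 1"
          unfolding LG1_overpartitions_def is_overpartition_def over non_over fst_m mem_Collect_eq
          by blast+
      qed
      then have "xs \<in> ?X"
        using sorted by (auto simp: is_partition_def odd_bounded_set_def len)
      with ps_eq show "ps \<in> ?m ` ?X" by blast
    qed
    show "?m ` ?X \<subseteq> LG1_overpartitions n"
    proof
      fix ps assume "ps \<in> ?m ` ?X"
      then obtain xs where ps: "ps = ?m xs" and sorted: "sorted_wrt (>) xs"
        and bdd: "odd_bounded_set (set xs)" and sum: "sum_list xs = n"
        by auto
      have "sorted_wrt (\<ge>) xs"
        by (rule sorted_wrt_mono_rel[OF _ sorted]) auto
      then have "is_partition n (map fst ps)"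
        using bdd sum unfolding ps fst_m
        by (auto simp: is_partition_def odd_bounded_set_def intro: gr0I)
      moreover have "\<not> snd (ps ! i)"
        if "i < j" "j < length ps" "fst (ps ! i) = fst (ps ! j)" for i j
      proof -
        have "xs ! j < xs ! i"
          using that(1,2) sorted by (simp add: ps sorted_wrt_iff_nth_less)
        then show ?thesis
          using that by (simp add: ps)
      qed
      ultimately have "is_overpartition n ps"
        unfolding is_overpartition_def by blast
      moreover have "distinct (filter even xs)"
        using sorted_wrt_gt_distinct[OF sorted] by simp
      moreover have "overlined ps = filter odd xs" "non_overlined ps = filter even xs"
        unfolding ps by (rule over, rule non_over)
      ultimately show "ps \<in> LG1_overpartitions n"
        using bdd by (simp add: LG1_overpartitions_def odd_bounded_set_def len[OF sorted])
    qed
  qed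
qed

lemma bij_betw_magnitudes:
  "bij_betw (\<lambda>ps. set (map fst ps)) (LG1_overpartitions n) {S. odd_bounded_set S \<and> \<Sum>S = n}"
proof -
  let ?X = "{xs. sorted_wrt (>) xs \<and> odd_bounded_set (set xs) \<and> sum_list xs = n}"
  have sum_eq: "\<Sum>(set xs) = sum_list xs" if "sorted_wrt (>) xs" for xs :: "nat list"
    using sum_list_distinct_conv_sum_set[OF sorted_wrt_gt_distinct[OF that], of "\<lambda>x. x"] by simp
  have "inj_on (\<lambda>ps. set (map fst ps)) (LG1_overpartitions n)"
  proof (rule inj_onI)
    fix ps qs
    assume ps: "ps \<in> LG1_overpartitions n" and qs: "qs \<in> LG1_overpartitions n"
      and eq: "set (map fst ps) = set (map fst qs)"
    have fsts: "map fst ps = map fst qs"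
      using LG1_overpartition_props(2)[OF ps] LG1_overpartition_props(2)[OF qs] eq
      by (rule sorted_wrt_gt_unique)
    have "rs = map (\<lambda>x. (x, odd x)) (map fst rs)" if "rs \<in> LG1_overpartitions n" for rs
      using that unfolding LG1_overpartitions_eq by (auto simp: comp_def)
    from this[OF ps] this[OF qs] show "ps = qs"
      by (simp only: fsts)
  qed
  moreover have "(\<lambda>ps. set (map fst ps)) ` LG1_overpartitions n = set ` ?X"
    unfolding LG1_overpartitions_eq by (simp add: image_image)
  moreover have "set ` ?X = {S. odd_bounded_set S \<and> \<Sum>S = n}"
  proof
    show "set ` ?X \<subseteq> {S. odd_bounded_set S \<and> \<Sum>S = n}"
      by (auto simp: sum_eq)
    show "{S. odd_bounded_set S \<and> \<Sum>S = n} \<subseteq> set ` ?X"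
    proof
      fix S assume S: "S \<in> {S. odd_bounded_set S \<and> \<Sum>S = n}"
      define xs where "xs = rev (sorted_list_of_set S)"
      have "set xs = S" "sorted_wrt (>) xs"
        using S by (auto simp: xs_def odd_bounded_set_def sorted_wrt_rev)
      then show "S \<in> set ` ?X"
        using S sum_eq[of xs] by force
    qed
  qed
  ultimately show ?thesis
    by (simp add: bij_betw_def)
qed

theorem theorem5p1:
  fixes n :: nat
  shows "LG1 n = LG1_over n"
  unfolding LG1_def LG1_over_def
  by (simp only: bij_betw_same_card[OF bij_betw_magnitudes]
      bij_betw_same_card[OF bij_betw_mark_set, symmetric]
      bij_betw_same_card[OF bij_betw_distribute])

end
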